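(* Let $\mu$ be a positive finite Borel measure on $[0,1)$ and let $v,w$ be weights on $\mathbb{D}$. Consider: (i) $C(v,w):=\sup_{0\le r<1}w(r)\int_0^1\frac{d\mu(t)}{v(t)(1-tr)}<\infty$; (ii) $I_\mu:H^\infty_v\to H^\infty_w$ is well defined and continuous. Then (i) implies (ii). If in addition $v$ is essential, then (i) and (ii) are equivalent.
   Context: $\mathbb{D}$ is the open unit disc and $H(\mathbb{D})$ the holomorphic functions on $\mathbb{D}$. A weight is a function $v:\mathbb{D}\to(0,\infty)$ that is radial ($v(z)=v(|z|)$), continuous, non-increasing in $|z|$, with $\lim_{r\to1^-}v(r)=0$. $H^\infty_v=\{f\in H(\mathbb{D}):\|f\|_v:=\sup_{z\in\mathbb{D}}v(z)|f(z)|<\infty\}$. A weight $v$ is essential if there is $c>0$ with $c/v(z)\le\sup\{|f(z)|:\|f\|_v\le1\}\le1/v(z)$ for all $z\in\mathbb{D}$. $I_\mu(f)(z)=\int_0^1\frac{f(t)}{1-tz}\,d\mu(t)$ whenever this defines a holomorphic function on $\mathbb{D}$. *)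

theory Defs
  imports "HOL-Analysis.Analysis"
begin

abbreviation unit_disc :: "complex set" where
  "unit_disc \<equiv> ball 0 1"

definition is_weight :: "(complex \<Rightarrow> real) \<Rightarrow> bool" where
  "is_weight v \<longleftrightarrow>
     (\<forall>z\<in>unit_disc. v z > 0) \<and>
     (\<forall>z\<in>unit_disc. v z = v (complex_of_real (norm z))) \<and>
     continuous_on unit_disc v \<and>
     (\<forall>z\<in>unit_disc. \<forall>u\<in>unit_disc. norm z \<le> norm u \<longrightarrow> v u \<le> v z) \<and>
     ((\<lambda>r. v (complex_of_real r)) \<longlongrightarrow> 0) (at_left 1)"

definition in_Hv :: "(complex \<Rightarrow> real) \<Rightarrow> (complex \<Rightarrow> complex) \<Rightarrow> bool" where
  "in_Hv v f \<longleftrightarrow> f holomorphic_on unit_disc \<and>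
     bdd_above ((\<lambda>z. v z * norm (f z)) ` unit_disc)"

definition Hv_norm :: "(complex \<Rightarrow> real) \<Rightarrow> (complex \<Rightarrow> complex) \<Rightarrow> real" where
  "Hv_norm v f = (SUP z\<in>unit_disc. v z * norm (f z))"

definition essential_weight :: "(complex \<Rightarrow> real) \<Rightarrow> bool" where
  "essential_weight v \<longleftrightarrow>
     (\<exists>c>0. \<forall>z\<in>unit_disc.
        c / v z \<le> Sup {norm (f z) | f. in_Hv v f \<and> Hv_norm v f \<le> 1} \<and>
        Sup {norm (f z) | f. in_Hv v f \<and> Hv_norm v f \<le> 1} \<le> 1 / v z)"

text \<open>The operator I_mu (a measure on the reals concentrated on [0,1)).\<close>
definition I_mu :: "real measure \<Rightarrow> (complex \<Rightarrow> complex) \<Rightarrow> complex \<Rightarrow> complex" where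
  "I_mu M f z = (LINT t|M. f (complex_of_real t) / (1 - complex_of_real t * z))"

definition C_vw :: "real measure \<Rightarrow> (complex \<Rightarrow> real) \<Rightarrow> (complex \<Rightarrow> real) \<Rightarrow> ennreal" where
  "C_vw M v w = (SUP r\<in>{0..<1::real}. ennreal (w (complex_of_real r)) *
      (\<integral>\<^sup>+ t. ennreal (1 / (v (complex_of_real t) * (1 - t * r))) \<partial>M))"

text \<open>Condition (ii): I_mu : H^infty_v \<rightarrow> H^infty_w is well defined and continuous
  (i.e. bounded, as it is linear).\<close>
definition I_mu_bounded :: "real measure \<Rightarrow> (complex \<Rightarrow> real) \<Rightarrow> (complex \<Rightarrow> real) \<Rightarrow> bool" where
  "I_mu_bounded M v w \<longleftrightarrow>
     (\<forall>f. in_Hv v f \<longrightarrow>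
        (\<forall>z\<in>unit_disc. integrable M (\<lambda>t. f (complex_of_real t) / (1 - complex_of_real t * z))) \<and>
        in_Hv w (I_mu M f)) \<and>
     (\<exists>C. \<forall>f. in_Hv v f \<longrightarrow> Hv_norm w (I_mu M f) \<le> C * Hv_norm v f)"

end

theory Submission
  imports Defs "HOL-Complex_Analysis.Complex_Analysis"
begin

text \<open>
  If \<open>C(v,w)\<close> is finite, then \<open>\<bar>f t\<bar> \<le> \<parallel>f\<parallel> / v t\<close> bounds the integral, and expanding the kernel
  into a geometric series exhibits \<open>I_mu f\<close> as a power series.

  Conversely, let \<open>v\<close> be essential and \<open>\<phi> = 1 / v\<close>. The maximum principle for \<open>f z / z^n\<close> on
  annuli shows that at every radius \<open>r \<ge> 1/2\<close> some monomial with natural exponent equals \<open>\<phi>\<close>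
  at \<open>r\<close> and is at most \<open>K \<phi>\<close> on \<open>[1/2,1)\<close>. A greedy choice of such monomials, in the style of
  Erdos and Kovari, switches from one to the next only after \<open>\<phi>\<close> has outgrown the current one;
  away from its own interval each chosen monomial then decays geometrically. So the partial sums
  have nonnegative coefficients, are uniformly bounded in \<open>H_v\<close>, and eventually dominate a fixed
  multiple of \<open>\<phi>\<close> at every point of \<open>[0,1)\<close>. Applying the operator to them and using monotone
  convergence bounds \<open>C(v,w)\<close>.
\<close>

section \<open>Sums of monomials comparable to a growth function\<close>

text \<open>In logarithmic coordinates \<open>tangent\<close> says: through each point of the graph
  of \<open>\<phi>\<close> runs a line of natural slope that stays below the graph up to the
  additive constant \<open>ln K\<close>. This is log-convexity up to constants, and it is what
  essentiality of a weight provides.\<close>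

locale log_tangent =
  fixes \<phi> :: "real \<Rightarrow> real" and K :: real
  assumes cont: "continuous_on {0..<1} \<phi>"
    and pos: "\<And>x. x \<in> {0..<1} \<Longrightarrow> \<phi> x > 0"
    and mono: "\<And>x y. 0 \<le> x \<Longrightarrow> x \<le> y \<Longrightarrow> y < 1 \<Longrightarrow> \<phi> x \<le> \<phi> y"
    and at_top: "filterlim \<phi> at_top (at_left 1)"
    and K: "K \<ge> 1"
    and tangent: "\<And>r. r \<in> {1/2..<1} \<Longrightarrow> \<exists>m. \<forall>x\<in>{1/2..<1}. \<phi> r * (x / r) ^ m \<le> K * \<phi> x"
begin

definition idx :: "real \<Rightarrow> nat" where
  "idx p = (GREATEST n. \<forall>x\<in>{p<..<1}. \<phi> p * (x / p) ^ n \<le> 4 * K * \<phi> x)"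

text \<open>
  The monomial attached to \<open>p\<close>, divided by \<open>4 * K\<close>, is the steepest one below \<open>\<phi>\<close> on \<open>(p,1)\<close> that
  passes through the point lying a factor \<open>4 * K\<close> below the graph of \<open>\<phi>\<close> at \<open>p\<close>. Without the
  slack, consecutive exponents could be so close that the monomials do not separate.
\<close>
definition mon :: "real \<Rightarrow> real \<Rightarrow> real" where
  "mon p x = \<phi> p * (x / p) ^ idx p"

text \<open>The switching point of the greedy choice: beyond it \<open>\<phi>\<close> stays above
  the monomial of \<open>p\<close>.\<close>

definition nxt :: "real \<Rightarrow> real" where
  "nxt p = Sup {x \<in> {p..<1}. \<phi> x \<le> mon p x}"

section \<open>One greedy step: the exponent at a point, the switching point, and the gap to the
  next exponent\<close>

context
  fixes p :: real
  assumes p: "p \<in> {1/2..<1}"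
begin

text \<open>At a fixed \<open>y > p\<close> the powers of \<open>y / p\<close> are unbounded, so the
  admissible exponents are bounded, as \<open>GREATEST\<close> in \<open>idx\<close>
  requires.\<close>

lemma idx_bounded:
  "\<exists>b. \<forall>n. (\<forall>x\<in>{p<..<1}. \<phi> p * (x / p) ^ n \<le> 4 * K * \<phi> x) \<longrightarrow> n \<le> b"
proof -
  define y where "y = (p + 1) / 2"
  have y: "p < y" "y < 1" using p by (auto simp: y_def)
  have "1 < y / p" using p y by auto
  then obtain b where b: "4 * K * \<phi> y / \<phi> p < (y / p) ^ b"
    using real_arch_pow by blast
  have "n \<le> b" if "\<forall>x\<in>{p<..<1}. \<phi> p * (x / p) ^ n \<le> 4 * K * \<phi> x" for n
  proof (rule ccontr)
    assume "\<not> n \<le> b"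
    then have "(y / p) ^ b \<le> (y / p) ^ n"
      using \<open>1 < y / p\<close> by (intro power_increasing) auto
    moreover have "\<phi> p * (y / p) ^ n \<le> 4 * K * \<phi> y" using that y by auto
    moreover have "\<phi> p > 0" using pos p by auto
    moreover have "4 * K * \<phi> y < (y / p) ^ b * \<phi> p"
      using b \<open>\<phi> p > 0\<close> by (simp only: pos_divide_less_eq)
    ultimately show False
      using mult_left_mono[of "(y / p) ^ b" "(y / p) ^ n" "\<phi> p"]
        mult.commute[of "\<phi> p" "(y / p) ^ b"] by linarith
  qed
  then show ?thesis by blast
qed

lemma mon_le:
  assumes "p \<le> x" "x < 1"
  shows "mon p x \<le> 4 * K * \<phi> x"
proof (cases "x = p")
  case True
  have "\<phi> p > 0" using pos p by auto
  then have "1 * \<phi> p \<le> 4 * K * \<phi> p" using K by (intro mult_right_mono) auto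
  then show ?thesis using True p by (simp add: mon_def)
next
  case False
  \<comment> \<open>Exponent 0 is admissible because \<open>\<phi>\<close> is monotone; together
    with the bound on exponents this makes \<open>GREATEST\<close> a true maximum.\<close>
  have "\<forall>x\<in>{p<..<1}. \<phi> p * (x / p) ^ 0 \<le> 4 * K * \<phi> x"
  proof
    fix x assume x: "x \<in> {p<..<1}"
    have "\<phi> p \<le> \<phi> x" "\<phi> x > 0" using x p by (auto intro!: mono pos)
    moreover have "1 * \<phi> x \<le> 4 * K * \<phi> x" using K \<open>\<phi> x > 0\<close> by (intro mult_right_mono) auto
    ultimately show "\<phi> p * (x / p) ^ 0 \<le> 4 * K * \<phi> x"
      unfolding power_0 mult_1_right by linarith
  qed
  note zero = this
  obtain b where
    b: "\<forall>n. (\<forall>x\<in>{p<..<1}. \<phi> p * (x / p) ^ n \<le> 4 * K * \<phi> x) \<longrightarrow> n \<le> b"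
    using idx_bounded by blast
  have "\<forall>x\<in>{p<..<1}. \<phi> p * (x / p) ^ idx p \<le> 4 * K * \<phi> x"
    unfolding idx_def
    by (rule GreatestI_nat[where P = "\<lambda>n. \<forall>x\<in>{p<..<1}. \<phi> p * (x / p) ^ n \<le> 4 * K * \<phi> x", OF zero])
      (use b in blast)
  then show ?thesis using assms False by (auto simp: mon_def)
qed

lemma idx_ge:
  assumes "\<And>x. p < x \<Longrightarrow> x < 1 \<Longrightarrow> \<phi> p * (x / p) ^ n \<le> 4 * K * \<phi> x"
  shows "n \<le> idx p"
proof -
  obtain b where
    b: "\<forall>n. (\<forall>x\<in>{p<..<1}. \<phi> p * (x / p) ^ n \<le> 4 * K * \<phi> x) \<longrightarrow> n \<le> b"
    using idx_bounded by blast
  show ?thesis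
    unfolding idx_def
  proof (rule Greatest_le_nat)
    show "\<forall>x\<in>{p<..<1}. \<phi> p * (x / p) ^ n \<le> 4 * K * \<phi> x"
      by (intro ballI assms) (simp_all only: greaterThanLessThan_iff)
    show "k \<le> b" if "\<forall>x\<in>{p<..<1}. \<phi> p * (x / p) ^ k \<le> 4 * K * \<phi> x" for k
      using b that by blast
  qed
qed

text \<open>
  Raising the exponent by one violates maximality, and costs at most a factor \<open>t / p < 2\<close>.
\<close>
lemma mon_near_tangent: "\<exists>t. p < t \<and> t < 1 \<and> 2 * K * \<phi> t < mon p t"
proof -
  have "\<not> Suc (idx p) \<le> idx p" by simp
  then obtain t where t: "p < t" "t < 1" "\<phi> p * (t / p) ^ Suc (idx p) > 4 * K * \<phi> t"
    using idx_ge[of "Suc (idx p)"] by (meson not_le)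
  have "\<phi> p > 0" using pos p by auto
  then have "mon p t > 0" using t p by (auto simp: mon_def)
  have "4 * K * \<phi> t < mon p t * (t / p)" using t by (simp add: mon_def mult_ac)
  also have "\<dots> \<le> mon p t * 2" using t p \<open>mon p t > 0\<close>
    by (intro mult_left_mono) (auto simp: field_simps)
  finally show ?thesis using t by auto
qed

text \<open>Near 1 the monomial stays bounded while \<open>\<phi>\<close> tends to infinity, so the
  supremum is taken over a nonempty compact set and is attained. Just to its right the monomial is
  at most \<open>\<phi>\<close>, and continuity turns the inequality into equality.\<close>

lemma nxt_props:
  shows nxt_bounds: "p \<le> nxt p" "nxt p < 1"
    and nxt_mon_eq: "mon p (nxt p) = \<phi> (nxt p)"
    and nxt_upper: "\<And>x. p \<le> x \<Longrightarrow> x < 1 \<Longrightarrow> \<phi> x \<le> mon p x \<Longrightarrow> x \<le> nxt p"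
proof -
  define S where "S = {x \<in> {p..<1}. \<phi> x \<le> mon p x}"
  have pp: "\<phi> p > 0" using pos p by auto
  have "eventually (\<lambda>x. \<phi> x > \<phi> p * (1 / p) ^ idx p) (at_left 1)"
    using at_top by (simp add: filterlim_at_top_dense)
  then obtain b where b: "b < 1" "\<And>x. b < x \<Longrightarrow> x < 1 \<Longrightarrow> \<phi> x > \<phi> p * (1 / p) ^ idx p"
    unfolding eventually_at_left_field by auto
  have big: "\<phi> x > mon p x" if "b < x" "p \<le> x" "x < 1" for x
  proof -
    have "mon p x \<le> \<phi> p * (1 / p) ^ idx p" unfolding mon_def
      using pp p that by (intro mult_left_mono power_mono) (auto simp: field_simps)
    then show ?thesis using b that by force
  qed
  define b' where "b' = max b p"
  have b': "b' < 1" "p \<le> b'" using b p by (auto simp: b'_def)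
  \<comment> \<open>The interval \<open>{p..<1}\<close> is not closed; cutting it at
    \<open>b'\<close> loses no point of \<open>S\<close> and makes \<open>S\<close> visibly
    closed.\<close>
  have S_eq: "S = {x \<in> {p..b'}. \<phi> x \<le> mon p x}"
    using big b' by (auto simp: S_def b'_def not_less[symmetric])
  have mcont: "continuous_on A (mon p)" for A
    unfolding mon_def using p by (intro continuous_intros) auto
  have "closed S" unfolding S_eq
  proof (intro continuous_on_closed_Collect_le mcont)
    show "continuous_on {p..b'} \<phi>"
      by (rule continuous_on_subset[OF cont]) (use b' p in \<open>auto simp: le_less_trans\<close>)
  qed simp
  moreover have pS: "p \<in> S" using p by (auto simp: S_def mon_def)
  moreover have bdd: "bdd_above S" unfolding S_eq by (rule bdd_aboveI[of _ b']) auto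
  ultimately have mem: "nxt p \<in> S"
    unfolding nxt_def S_def[symmetric] by (intro closed_contains_Sup) auto
  then show nb: "p \<le> nxt p" "nxt p < 1" by (auto simp: S_def)
  show up: "x \<le> nxt p" if "p \<le> x" "x < 1" "\<phi> x \<le> mon p x" for x
    using bdd that unfolding nxt_def S_def[symmetric] by (intro cSup_upper) (auto simp: S_def)
  let ?q = "nxt p"
  have "\<phi> ?q \<ge> mon p ?q"
  proof (rule tendsto_le)
    show "at_right ?q \<noteq> bot" by simp
    have "isCont \<phi> ?q"
      using nb p continuous_on_subset[OF cont, of "{0<..<1}"]
      by (intro continuous_on_interior[OF cont]) (auto simp: interior_atLeastLessThan)
    then show "(\<phi> \<longlongrightarrow> \<phi> ?q) (at_right ?q)"
      unfolding isCont_def by (rule filterlim_mono) (auto intro: at_le)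
    have "isCont (mon p) ?q" using mcont[of UNIV] by (simp add: continuous_on_eq_continuous_at)
    then show "(mon p \<longlongrightarrow> mon p ?q) (at_right ?q)"
      unfolding isCont_def by (rule filterlim_mono) (auto intro: at_le)
    have "mon p x \<le> \<phi> x" if "?q < x" "x < 1" for x
      using up[of x] that nb by linarith
    then show "eventually (\<lambda>x. mon p x \<le> \<phi> x) (at_right ?q)"
      using nb eventually_at_right_field by blast
  qed
  then show "mon p ?q = \<phi> ?q" using mem by (auto simp: S_def)
qed

text \<open>Since \<open>2 * K \<ge> 1\<close>, the point from \<open>mon_near_tangent\<close> still
  satisfies \<open>\<phi> t \<le> mon p t\<close> and so cannot lie beyond \<open>nxt p\<close>. In
  particular the greedy step moves strictly forward.\<close>

lemma near_tangent_le_nxt: "\<exists>t. p < t \<and> t \<le> nxt p \<and> 2 * K * \<phi> t < mon p t"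
proof -
  obtain t where t: "p < t" "t < 1" "2 * K * \<phi> t < mon p t" using mon_near_tangent by blast
  have "1 * \<phi> t \<le> 2 * K * \<phi> t" using K pos[of t] t p by (intro mult_right_mono) auto
  then show ?thesis using t nxt_upper[of t] by (intro exI[of _ t]) auto
qed

lemma nxt_in: "nxt p \<in> {1/2..<1}" and nxt_gt: "p < nxt p"
  using near_tangent_le_nxt nxt_bounds p by auto

text \<open>The monomial meets \<open>\<phi>\<close> at \<open>nxt p\<close> as well; anchoring it
  there lets consecutive monomials be compared at a common point.\<close>

lemma mon_rebase: "mon p x = \<phi> (nxt p) * (x / nxt p) ^ idx p"
  using nxt_mon_eq[symmetric] nxt_in p by (simp add: mon_def power_divide)

text \<open>Anchored at \<open>nxt p\<close>, the old monomial still obeys \<open>mon_le\<close>, so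
  its exponent competes in the maximum that defines \<open>idx (nxt p)\<close>.\<close>

lemma idx_nxt: "idx p \<le> idx (nxt p)"
proof (rule log_tangent.idx_ge[OF log_tangent_axioms nxt_in])
  fix x assume "nxt p < x" "x < 1"
  then show "\<phi> (nxt p) * (x / nxt p) ^ idx p \<le> 4 * K * \<phi> x"
    using mon_le[of x] nxt_gt by (simp add: mon_rebase)
qed

lemma mon_nxt: "mon (nxt p) x = mon p x * (x / nxt p) ^ (idx (nxt p) - idx p)"
  using idx_nxt by (simp add: mon_rebase mon_def[of "nxt p"] flip: power_add)

text \<open>At some \<open>t\<close> between \<open>p\<close> and \<open>nxt p\<close> the old
  monomial exceeds \<open>2 * K * \<phi> t\<close>, while the tangent monomial at
  \<open>nxt p\<close>, and hence the steeper new one, is at most \<open>K * \<phi> t\<close>. So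
  the new monomial is below half the old one at \<open>t\<close>, and the ratio only improves
  further left, at \<open>p\<close>.\<close>

lemma ratio_backward: "2 \<le> (nxt p / p) ^ (idx (nxt p) - idx p)"
proof -
  let ?q = "nxt p" and ?d = "idx (nxt p) - idx p"
  have q: "1/2 \<le> ?q" "?q < 1" "p < ?q" using nxt_in nxt_gt by auto
  have fq: "\<phi> ?q > 0" using q pos by auto
  obtain m where m: "\<And>x. x \<in> {1/2..<1} \<Longrightarrow> \<phi> ?q * (x / ?q) ^ m \<le> K * \<phi> x"
    using tangent[OF nxt_in] by blast
  have "m \<le> idx ?q"
  proof (rule log_tangent.idx_ge[OF log_tangent_axioms nxt_in])
    fix x assume x: "nxt p < x" "x < 1"
    then have "\<phi> x > 0" using q pos by auto
    then have "K * \<phi> x \<le> 4 * K * \<phi> x" using K by (intro mult_right_mono) auto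
    then show "\<phi> ?q * (x / ?q) ^ m \<le> 4 * K * \<phi> x" using m[of x] x q by auto
  qed
  obtain t where t: "p < t" "t \<le> ?q" "2 * K * \<phi> t < mon p t"
    using near_tangent_le_nxt by blast
  have t1: "0 < t / ?q" "t / ?q \<le> 1" using t q p by auto
  have "\<phi> ?q * (2 * (t / ?q) ^ idx ?q) \<le> \<phi> ?q * (2 * (t / ?q) ^ m)"
    using t1 \<open>m \<le> idx ?q\<close> fq by (intro mult_left_mono power_decreasing) auto
  also have "\<dots> \<le> 2 * K * \<phi> t" using m[of t] t q p by auto
  also have "\<dots> < \<phi> ?q * (t / ?q) ^ idx p" using t by (simp add: mon_rebase)
  finally have "2 * (t / ?q) ^ idx ?q < (t / ?q) ^ idx p" using fq by simp
  moreover have "(t / ?q) ^ idx ?q = (t / ?q) ^ idx p * (t / ?q) ^ ?d"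
    using idx_nxt by (simp flip: power_add)
  ultimately have "(t / ?q) ^ idx p * (2 * (t / ?q) ^ ?d) < (t / ?q) ^ idx p * 1"
    by (simp add: mult_ac)
  then have "2 * (t / ?q) ^ ?d < 1" using t1 by (subst (asm) mult_less_cancel_left_pos) auto
  then have "2 < (?q / t) ^ ?d" using t q p by (simp add: power_divide field_simps)
  also have "\<dots> \<le> (?q / p) ^ ?d" using t q p by (intro power_mono) (auto simp: field_simps)
  finally show ?thesis by simp
qed

text \<open>Beyond \<open>nxt p\<close> the old monomial is below \<open>\<phi>\<close>, whereas the
  new one exceeds \<open>2 * K * \<phi> t\<close> at some \<open>t\<close> not beyond the following
  switch. As \<open>K \<ge> 1\<close>, their ratio has passed 2 by then.\<close>

lemma ratio_forward: "2 \<le> (nxt (nxt p) / nxt p) ^ (idx (nxt p) - idx p)"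
proof -
  let ?q = "nxt p" and ?d = "idx (nxt p) - idx p"
  have q: "1/2 \<le> ?q" "?q < 1" "p < ?q" using nxt_in nxt_gt by auto
  obtain t where t: "?q < t" "t \<le> nxt ?q" "2 * K * \<phi> t < mon ?q t"
    using log_tangent.near_tangent_le_nxt[OF log_tangent_axioms nxt_in] by blast
  have t1: "t < 1" using t log_tangent.nxt_in[OF log_tangent_axioms nxt_in] by auto
  have ft: "\<phi> t > 0" using t t1 q pos by auto
  have less: "mon p t < \<phi> t" using nxt_upper[of t] t t1 q by force
  have mp: "mon p t > 0" using pos[of p] p t q by (auto simp: mon_def)
  have "2 * mon p t < 2 * K * \<phi> t"
    using less mult_right_mono[OF K, of "\<phi> t"] ft by linarith
  also have "\<dots> < mon p t * (t / ?q) ^ ?d" using t by (simp add: mon_nxt)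
  finally have "2 < (t / ?q) ^ ?d" using mp by (simp add: mult.commute)
  also have "\<dots> \<le> (nxt ?q / ?q) ^ ?d" using t q by (intro power_mono) (auto simp: field_simps)
  finally show ?thesis by simp
qed

lemma idx_nxt_less: "idx p < idx (nxt p)"
  using ratio_backward by (cases "idx (nxt p) - idx p") auto

text \<open>If \<open>\<phi> x\<close> were larger, the tangent monomial at \<open>x\<close> would
  lie strictly below \<open>mon p\<close>, relative to the values at \<open>x\<close>, at both
  \<open>p\<close> and \<open>nxt p\<close>, where \<open>mon p\<close> equals
  \<open>\<phi>\<close>. The left point forces its exponent above \<open>idx p\<close>, the right
  point below.\<close>

lemma le_mon:
  assumes "p \<le> x" "x \<le> nxt p"
  shows "\<phi> x \<le> K * mon p x"
proof (rule ccontr)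
  let ?q = "nxt p"
  assume "\<not> ?thesis"
  then have big: "K * mon p x < \<phi> x" by simp
  have q: "1/2 \<le> ?q" "?q < 1" "p < ?q" using nxt_in nxt_gt by auto
  have x: "x \<in> {1/2..<1}" using assms q p by auto
  obtain m where m: "\<And>y. y \<in> {1/2..<1} \<Longrightarrow> \<phi> x * (y / x) ^ m \<le> K * \<phi> y"
    using tangent[OF x] by blast
  have mx: "mon p x > 0" using pos[of p] p x by (auto simp: mon_def)
  have key: "(y / x) ^ m < (y / x) ^ idx p" if y: "y \<in> {1/2..<1}" "\<phi> y = mon p y" for y
  proof -
    have yx: "y / x > 0" using x y by auto
    have "K * mon p x * (y / x) ^ m < \<phi> x * (y / x) ^ m"
      using big yx by (intro mult_strict_right_mono) auto
    also have "\<dots> \<le> K * mon p y" using m[of y] y by simp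
    also have "mon p y = mon p x * (y / x) ^ idx p"
      using x p by (simp add: mon_def power_divide)
    finally have "(K * mon p x) * (y / x) ^ m < (K * mon p x) * (y / x) ^ idx p" by simp
    then show ?thesis using mx K by (subst (asm) mult_less_cancel_left_pos) auto
  qed
  have "(p / x) ^ m < (p / x) ^ idx p" using key[of p] p by (simp add: mon_def)
  then have "idx p < m"
  proof (rule contrapos_pp)
    assume "\<not> idx p < m"
    then show "\<not> (p / x) ^ m < (p / x) ^ idx p"
      using assms x p by (auto simp: not_less intro!: power_decreasing)
  qed
  have "(?q / x) ^ m < (?q / x) ^ idx p" using key[of ?q] nxt_in nxt_mon_eq by simp
  then have "m < idx p"
  proof (rule contrapos_pp)
    assume "\<not> m < idx p"
    then show "\<not> (?q / x) ^ m < (?q / x) ^ idx p"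
      using assms x by (auto simp: not_less intro!: power_increasing)
  qed
  with \<open>idx p < m\<close> show False by simp
qed

end

section \<open>The greedy sequence of nodes, started at 1/2\<close>

definition node :: "nat \<Rightarrow> real" where "node k = (nxt ^^ k) (1/2)"

lemma node_0: "node 0 = 1/2" and node_Suc: "node (Suc k) = nxt (node k)"
  by (simp_all add: node_def)

lemma node_in: "node k \<in> {1/2..<1}"
  by (induction k) (simp add: node_0, simp only: node_Suc nxt_in)

lemma strict_mono_node: "strict_mono node"
  unfolding strict_mono_Suc_iff by (simp add: node_Suc nxt_gt[OF node_in])

lemma idx_node_ge: "k \<le> idx (node k)"
proof (induction k)
  case (Suc k)
  then show ?case using idx_nxt_less[OF node_in[of k]] by (simp add: node_Suc)
qed simp

text \<open>If the nodes stayed below some \<open>x < 1\<close>, their monomials, whose exponents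
  tend to infinity, would be unbounded at a fixed \<open>y > x\<close>, against
  \<open>mon_le\<close>.\<close>

lemma node_cofinal:
  assumes "x < 1"
  shows "\<exists>k. x < node k"
proof (rule ccontr)
  assume "\<not> ?thesis"
  then have le: "node k \<le> x" for k by (meson not_le)
  then have x: "1/2 \<le> x" using node_0 by metis
  define y where "y = (x + 1) / 2"
  have y: "x < y" "y < 1" using assms by (auto simp: y_def)
  then have "1 < y / x" using x by auto
  then obtain k where k: "4 * K * \<phi> y / \<phi> 0 < (y / x) ^ k"
    using real_arch_pow by blast
  have n: "1/2 \<le> node k" "node k < 1" using node_in[of k] by auto
  have "\<phi> 0 > 0" using pos by auto
  have "4 * K * \<phi> y < \<phi> 0 * (y / x) ^ k" using k \<open>\<phi> 0 > 0\<close> by (simp add: field_simps)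
  also have "\<dots> \<le> \<phi> (node k) * (y / node k) ^ idx (node k)"
  proof (intro mult_mono)
    show "\<phi> 0 \<le> \<phi> (node k)" using n by (intro mono) auto
    have "(y / x) ^ k \<le> (y / x) ^ idx (node k)"
      using \<open>1 < y / x\<close> idx_node_ge by (intro power_increasing) auto
    also have "\<dots> \<le> (y / node k) ^ idx (node k)"
      using n le[of k] y x by (intro power_mono) (auto intro!: divide_left_mono)
    finally show "(y / x) ^ k \<le> (y / node k) ^ idx (node k)" .
  qed (use \<open>\<phi> 0 > 0\<close> pos[of "node k"] n \<open>1 < y / x\<close> in auto)
  also have "\<dots> \<le> 4 * K * \<phi> y"
    using mon_le[OF node_in, of k y] le[of k] y by (simp add: mon_def)
  finally show False by simp
qed

section \<open>Geometric decay of the monomials away from their own intervals, and bounds for their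
  sums\<close>

lemma mon_node_nonneg: "0 \<le> x \<Longrightarrow> 0 \<le> mon (node k) x"
  using pos[of "node k"] node_in[of k] by (auto simp: mon_def)

lemma mon_node_Suc_le:
  assumes "0 \<le> x" "x \<le> node (Suc k)"
  shows "mon (node (Suc k)) x \<le> mon (node k) x"
proof -
  have h: "(x / node (Suc k)) ^ (idx (node (Suc k)) - idx (node k)) \<le> 1"
    using assms node_in[of "Suc k"] by (intro power_le_one) auto
  show ?thesis
    using mult_left_mono[OF h mon_node_nonneg[OF assms(1), of k]]
    by (simp add: node_Suc mon_nxt[OF node_in])
qed

lemma mon_node_Suc_le_half:
  assumes "0 \<le> x" "x \<le> node k"
  shows "mon (node (Suc k)) x \<le> mon (node k) x / 2"
proof -
  let ?d = "idx (node (Suc k)) - idx (node k)"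
  have n: "0 < node k" "0 < node (Suc k)" using node_in[of k] node_in[of "Suc k"] by auto
  have "(x / node (Suc k)) ^ ?d \<le> (node k / node (Suc k)) ^ ?d"
    using assms n by (intro power_mono divide_right_mono) auto
  also have "\<dots> \<le> 1 / 2"
    using ratio_backward[OF node_in[of k]] n by (simp add: power_divide node_Suc field_simps)
  finally have h: "(x / node (Suc k)) ^ ?d \<le> 1 / 2" .
  show ?thesis
    using mult_left_mono[OF h mon_node_nonneg[OF assms(1), of k]]
    by (simp add: node_Suc mon_nxt[OF node_in])
qed

lemma mon_node_le_Suc:
  assumes "node (Suc k) \<le> x"
  shows "mon (node k) x \<le> mon (node (Suc k)) x"
proof -
  have n: "0 < node (Suc k)" using node_in[of "Suc k"] by auto
  then have h: "1 \<le> (x / node (Suc k)) ^ (idx (node (Suc k)) - idx (node k))"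
    using assms by (intro one_le_power) auto
  show ?thesis
    using mult_left_mono[OF h mon_node_nonneg[of x k]] assms n
    by (simp add: node_Suc mon_nxt[OF node_in])
qed

text \<open>The factor 2 is available only one node after the switch, since
  \<open>ratio_forward\<close> measures the growth between \<open>node (Suc k)\<close> and
  \<open>node (Suc (Suc k))\<close>.\<close>

lemma mon_node_le_half_Suc:
  assumes "node (Suc (Suc k)) \<le> x"
  shows "mon (node k) x \<le> mon (node (Suc k)) x / 2"
proof -
  let ?d = "idx (node (Suc k)) - idx (node k)"
  have n: "0 < node (Suc k)" "0 < node (Suc (Suc k))"
    using node_in[of "Suc k"] node_in[of "Suc (Suc k)"] by auto
  have "2 \<le> (node (Suc (Suc k)) / node (Suc k)) ^ ?d"
    using ratio_forward[OF node_in[of k]] by (simp add: node_Suc)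
  also have "\<dots> \<le> (x / node (Suc k)) ^ ?d"
    using assms n by (intro power_mono divide_right_mono) auto
  finally have h: "2 \<le> (x / node (Suc k)) ^ ?d" .
  show ?thesis
    using mult_left_mono[OF h mon_node_nonneg[of x k]] assms n
    by (simp add: node_Suc mon_nxt[OF node_in])
qed

text \<open>Each monomial is at most half its successor here, so a sum bounded by its last neighbour
  \<open>mon (node k) x\<close> becomes at most twice that after adding it, which the next monomial
  again dominates.\<close>

lemma sum_earlier_le_aux:
  "node (Suc k) \<le> x \<Longrightarrow> (\<Sum>j<k. mon (node j) x) \<le> mon (node k) x"
proof (induction k)
  case 0
  then show ?case using mon_node_nonneg[of x 0] node_in[of "Suc 0"] by auto
next
  case (Suc k)
  have "node (Suc k) \<le> x"
    using Suc.prems strict_monoD[OF strict_mono_node, of "Suc k" "Suc (Suc k)"] by simp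
  then show ?case using Suc.IH mon_node_le_half_Suc[OF Suc.prems] by simp
qed

text \<open>From \<open>node k\<close> on, the halving covers only the indices before
  \<open>k - 1\<close>; the term \<open>k - 1\<close> is merely at most
  \<open>mon (node k) x\<close>, whence the factor 2.\<close>

lemma sum_earlier_le:
  assumes "node k \<le> x"
  shows "(\<Sum>j<k. mon (node j) x) \<le> 2 * mon (node k) x"
proof (cases k)
  case 0
  then show ?thesis using mon_node_nonneg[of x k] node_in[of k] assms by auto
next
  case (Suc k')
  then show ?thesis using sum_earlier_le_aux[of k' x] mon_node_le_Suc[of k' x] assms by simp
qed

lemma sum_later_le:
  assumes "0 \<le> x" "x \<le> node (Suc k)"
  shows "(\<Sum>j\<in>{k<..<n}. mon (node j) x) \<le> 2 * mon (node k) x"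
proof -
  \<comment> \<open>The first term past \<open>k\<close> gains nothing, because \<open>x\<close> may
    reach \<open>node (Suc k)\<close>; halving sets in after it, so the exponent is \<open>i\<close>
    and not \<open>Suc i\<close>.\<close>
  have half: "mon (node (Suc k + i)) x \<le> mon (node k) x * (1/2) ^ i" for i
  proof (induction i)
    case 0
    then show ?case using mon_node_Suc_le[OF assms] by simp
  next
    case (Suc i)
    have "x \<le> node (Suc k + i)"
      using assms(2) strict_mono_leD[OF strict_mono_node, of "Suc k" "Suc k + i"] by simp
    then show ?case using Suc mon_node_Suc_le_half[OF assms(1), of "Suc k + i"] by simp
  qed
  have "{k<..<n} = (\<lambda>i. Suc k + i) ` {..<n - Suc k}"
  proof (intro equalityI subsetI)
    fix j assume "j \<in> {k<..<n}"
    then show "j \<in> (\<lambda>i. Suc k + i) ` {..<n - Suc k}"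
      by (intro image_eqI[of _ _ "j - Suc k"]) auto
  qed auto
  then have "(\<Sum>j\<in>{k<..<n}. mon (node j) x) = (\<Sum>i<n - Suc k. mon (node (Suc k + i)) x)"
    by (simp add: sum.reindex inj_on_def)
  also have "\<dots> \<le> (\<Sum>i<n - Suc k. mon (node k) x * (1/2) ^ i)" by (intro sum_mono half)
  also have "\<dots> = mon (node k) x * (\<Sum>i<n - Suc k. (1/2) ^ i)" by (simp add: sum_distrib_left)
  also have "(\<Sum>i<n - Suc k. (1/2::real) ^ i) \<le> 2"
    by (subst sum_gp_strict) (auto simp: field_simps)
  then have "mon (node k) x * (\<Sum>i<n - Suc k. (1/2) ^ i) \<le> mon (node k) x * 2"
    by (intro mult_left_mono mon_node_nonneg assms)
  finally show ?thesis by simp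
qed

lemma node_interval:
  assumes "1/2 \<le> x" "x < node n"
  shows "\<exists>k<n. node k \<le> x \<and> x \<le> node (Suc k)"
  using assms
proof (induction n)
  case 0
  then show ?case by (simp add: node_0)
next
  case (Suc n)
  then show ?case by (cases "x < node n") (auto intro: less_SucI)
qed

lemma sum_mon_le:
  assumes "1/2 \<le> x" "x < 1"
  shows "(\<Sum>j<n. mon (node j) x) \<le> 20 * K * \<phi> x"
proof -
  obtain m where "x < node m" using node_cofinal assms by blast
  then obtain k where k: "node k \<le> x" "x \<le> node (Suc k)" using node_interval assms by blast
  have "{..<n} \<subseteq> {..<k} \<union> {k} \<union> {k<..<n}" by auto
  then have "(\<Sum>j<n. mon (node j) x) \<le> (\<Sum>j\<in>{..<k} \<union> {k} \<union> {k<..<n}. mon (node j) x)"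
    using assms by (intro sum_mono2) (auto intro: mon_node_nonneg)
  also have "\<dots> = (\<Sum>j<k. mon (node j) x) + mon (node k) x + (\<Sum>j\<in>{k<..<n}. mon (node j) x)"
    by (subst sum.union_disjoint; (subst sum.union_disjoint)?) auto
  \<comment> \<open>Earlier, own and later terms contribute 2 + 1 + 2; \<open>mon_le\<close> then
    supplies the factor \<open>4 * K\<close>.\<close>
  also have "\<dots> \<le> 5 * mon (node k) x"
    using sum_earlier_le[OF k(1)] sum_later_le[of x k n] k assms by auto
  also have "\<dots> \<le> 20 * K * \<phi> x" using mon_le[OF node_in k(1)] assms by simp
  finally show ?thesis .
qed

lemma le_sum_mon:
  assumes "1/2 \<le> x" "x < node n"
  shows "\<phi> x \<le> K * (\<Sum>j<n. mon (node j) x)"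
proof -
  obtain k where k: "k < n" "node k \<le> x" "x \<le> node (Suc k)" using node_interval assms by blast
  have "\<phi> x \<le> K * mon (node k) x" using le_mon[OF node_in] k by (simp add: node_Suc)
  also have "mon (node k) x \<le> (\<Sum>j<n. mon (node j) x)"
    using k assms by (intro member_le_sum) (auto intro: mon_node_nonneg)
  finally show ?thesis using K by simp
qed

section \<open>Test polynomials with nonnegative coefficients\<close>

definition test_poly :: "nat \<Rightarrow> complex \<Rightarrow> complex" where
  "test_poly n z = complex_of_real (\<phi> (1/2)) +
     (\<Sum>j<n. complex_of_real (\<phi> (node j)) * (z / complex_of_real (node j)) ^ idx (node j))"

definition test_real :: "nat \<Rightarrow> real \<Rightarrow> real" where
  "test_real n x = \<phi> (1/2) + (\<Sum>j<n. mon (node j) x)"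

text \<open>With D = \<open>\<phi> (1/2) / \<phi> 0\<close>, the summand D pays for the constant
  term, and \<open>20 * K\<close> for the monomials; the factor 1 + D carries their bound from
  [1/2,1) over to [0,1).\<close>

definition test_bound :: real where
  "test_bound = \<phi> (1/2) / \<phi> 0 + 20 * K * (1 + \<phi> (1/2) / \<phi> 0)"

lemma node_pos: "0 < node j" "0 < \<phi> (node j)"
  using node_in[of j] pos by auto

lemma test_poly_holomorphic: "test_poly n holomorphic_on A"
  unfolding test_poly_def
  by (intro holomorphic_intros) (use node_pos in \<open>auto simp: less_imp_neq[symmetric]\<close>)

lemma test_poly_of_real: "test_poly n (complex_of_real x) = complex_of_real (test_real n x)"
  by (simp add: test_poly_def test_real_def mon_def)

lemma norm_test_poly_le: "norm (test_poly n z) \<le> test_real n (norm z)"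
proof -
  have "0 < \<phi> (1/2)" using pos by auto
  have "norm (test_poly n z) \<le> norm (complex_of_real (\<phi> (1/2))) +
    norm (\<Sum>j<n. complex_of_real (\<phi> (node j)) * (z / complex_of_real (node j)) ^ idx (node j))"
    unfolding test_poly_def by (rule norm_triangle_ineq)
  also have "\<dots> \<le> \<phi> (1/2) + (\<Sum>j<n. mon (node j) (norm z))"
    using \<open>0 < \<phi> (1/2)\<close> node_pos by (intro add_mono sum_norm_le)
      (auto simp: mon_def norm_mult norm_power norm_divide less_imp_le)
  finally show ?thesis by (simp add: test_real_def)
qed

lemma test_real_mono: "0 \<le> x \<Longrightarrow> m \<le> n \<Longrightarrow> test_real m x \<le> test_real n x"
  unfolding test_real_def by (intro add_left_mono sum_mono2) (auto intro: mon_node_nonneg)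

lemma test_real_le:
  assumes x: "0 \<le> x" "x < 1"
  shows "test_real n x \<le> test_bound * \<phi> x"
proof -
  define D where "D = \<phi> (1/2) / \<phi> 0"
  have p0: "\<phi> 0 > 0" "\<phi> (1/2) > 0" "0 < D" "0 < \<phi> x" using pos x by (auto simp: D_def)
  have "\<phi> (1/2) = D * \<phi> 0" using p0 by (simp add: D_def)
  also have "\<dots> \<le> D * \<phi> x" using p0 x by (intro mult_left_mono mono) auto
  finally have half: "\<phi> (1/2) \<le> D * \<phi> x" .
  \<comment> \<open>The bound \<open>sum_mon_le\<close> starts at 1/2; smaller arguments are moved
    there, the monomials being nondecreasing.\<close>
  have "(\<Sum>j<n. mon (node j) x) \<le> (\<Sum>j<n. mon (node j) (max x (1/2)))"
    unfolding mon_def using x node_pos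
    by (intro sum_mono mult_left_mono power_mono divide_right_mono) (auto simp: less_imp_le)
  also have "\<dots> \<le> 20 * K * \<phi> (max x (1/2))" using x by (intro sum_mon_le) auto
  also have "\<phi> (max x (1/2)) \<le> (1 + D) * \<phi> x"
    using half p0 by (auto simp: max_def algebra_simps)
  then have "20 * K * \<phi> (max x (1/2)) \<le> 20 * K * ((1 + D) * \<phi> x)"
    using K by (intro mult_left_mono) auto
  finally show ?thesis
    using half by (simp add: test_real_def test_bound_def D_def[symmetric] algebra_simps)
qed

text \<open>The number of terms depends on \<open>x\<close>; a bound uniform in \<open>x\<close> is
  reached only by the supremum over \<open>n\<close>.\<close>

lemma le_test_real:
  assumes x: "0 \<le> x" "x < 1"
  shows "\<exists>n. \<phi> x \<le> K * test_real n x"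
proof (cases "x < 1/2")
  case True
  then have "\<phi> x \<le> \<phi> (1/2)" using x by (intro mono) auto
  also have "\<dots> \<le> K * \<phi> (1/2)" using K pos[of "1/2"] by simp
  finally show ?thesis by (intro exI[of _ 0]) (simp add: test_real_def)
next
  case False
  obtain n where "x < node n" using node_cofinal x by blast
  then have "\<phi> x \<le> K * (\<Sum>j<n. mon (node j) x)" using False by (intro le_sum_mon) auto
  also have "\<dots> \<le> K * test_real n x"
    using K pos[of "1/2"] by (intro mult_left_mono) (auto simp: test_real_def)
  finally show ?thesis by blast
qed

end

section \<open>Tangent monomials for essential weights\<close>

text \<open>The quotient \<open>f z / z ^ n\<close> is holomorphic on the closed annulus, whose
  frontier lies on the two circles; the maximum principle applies to it.\<close>

lemma annulus_maximum_modulus: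
  assumes f: "f holomorphic_on unit_disc"
    and r: "0 < r1" "r1 < r" "r < r2" "r2 < 1"
    and a: "\<And>z. norm z = r1 \<Longrightarrow> norm (f z) \<le> a"
    and b: "\<And>z. norm z = r2 \<Longrightarrow> norm (f z) \<le> b"
  shows "norm (f (complex_of_real r)) / r ^ n \<le> max (a / r1 ^ n) (b / r2 ^ n)"
proof -
  let ?g = "\<lambda>z::complex. f z / z ^ n"
  let ?S = "cball 0 r2 - ball 0 r1 :: complex set"
  have sub: "?S \<subseteq> unit_disc" using r by auto
  have nz: "z \<noteq> 0" if "z \<in> ?S" for z using that r by auto
  have hol: "?g holomorphic_on ?S"
    using nz by (intro holomorphic_intros holomorphic_on_subset[OF f sub]) auto
  have cl: "closed ?S" by (simp add: closed_Diff)
  have op: "ball 0 r2 - cball 0 r1 \<subseteq> interior ?S"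
    by (intro interior_maximal) (auto simp: open_Diff)
  have fr: "norm z = r1 \<or> norm z = r2" if "z \<in> frontier ?S" for z
  proof -
    have "z \<in> ?S" "z \<notin> interior ?S" using that cl by (auto simp: frontier_def)
    then have "z \<notin> ball 0 r2 - cball 0 r1" using op by blast
    then show ?thesis using \<open>z \<in> ?S\<close> by auto
  qed
  have "norm (?g (complex_of_real r)) \<le> max (a / r1 ^ n) (b / r2 ^ n)"
  proof (rule maximum_modulus_frontier[of ?g ?S])
    show "?g holomorphic_on interior ?S"
      by (rule holomorphic_on_subset[OF hol interior_subset])
    show "continuous_on (closure ?S) ?g"
      using hol cl by (simp add: holomorphic_on_imp_continuous_on)
    show "bounded ?S" by (meson Diff_subset bounded_cball bounded_subset)
    show "complex_of_real r \<in> ?S" using r by auto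
    fix z assume "z \<in> frontier ?S"
    from fr[OF this] show "norm (?g z) \<le> max (a / r1 ^ n) (b / r2 ^ n)"
    proof
      assume "norm z = r1"
      then have "norm (?g z) \<le> a / r1 ^ n"
        using a[of z] r by (simp add: norm_divide norm_power divide_right_mono)
      then show ?thesis by simp
    next
      assume "norm z = r2"
      then have "norm (?g z) \<le> b / r2 ^ n"
        using b[of z] r by (simp add: norm_divide norm_power divide_right_mono)
      then show ?thesis by simp
    qed
  qed
  then show ?thesis using r by (simp add: norm_divide norm_power)
qed

section \<open>Elementary facts on weights and the weighted norm\<close>

lemma
  assumes "is_weight v"
  shows weight_pos: "norm z < 1 \<Longrightarrow> v z > 0"
    and weight_radial: "norm z < 1 \<Longrightarrow> v (complex_of_real (norm z)) = v z"
    and weight_antimono: "norm z \<le> norm u \<Longrightarrow> norm u < 1 \<Longrightarrow> v u \<le> v z"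
    and weight_continuous_on: "continuous_on unit_disc v"
    and weight_tendsto: "((\<lambda>r. v (complex_of_real r)) \<longlongrightarrow> 0) (at_left 1)"
proof -
  note W = assms[unfolded is_weight_def]
  show "norm z < 1 \<Longrightarrow> v z > 0"
    by (rule bspec[OF conjunct1[OF W]]) simp
  show "norm z < 1 \<Longrightarrow> v (complex_of_real (norm z)) = v z"
    by (rule sym, rule bspec[OF conjunct1[OF conjunct2[OF W]]]) simp
  show "v u \<le> v z" if "norm z \<le> norm u" "norm u < 1"
  proof -
    have "z \<in> unit_disc" "u \<in> unit_disc" using that by auto
    with W that show ?thesis by blast
  qed
qed (use assms in \<open>unfold is_weight_def, blast+\<close>)

lemma weight_continuous_on_real:
  assumes "is_weight v"
  shows "continuous_on {0..<1} (\<lambda>x. v (complex_of_real x))"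
  by (rule continuous_on_compose2[OF weight_continuous_on[OF assms]])
    (auto intro!: continuous_intros)

lemma in_Hv_bound:
  assumes "in_Hv v f" "norm z < 1"
  shows "v z * norm (f z) \<le> Hv_norm v f"
  unfolding Hv_norm_def
  by (rule cSUP_upper[where f = "\<lambda>z. v z * norm (f z)"]) (use assms in \<open>simp_all add: in_Hv_def\<close>)

lemma in_Hv_norm_le:
  assumes "is_weight v" "in_Hv v f" "norm z < 1"
  shows "norm (f z) \<le> Hv_norm v f / v z"
  using in_Hv_bound[OF assms(2,3)] weight_pos[OF assms(1,3)] by (simp add: field_simps)

lemma Hv_norm_nonneg:
  assumes "is_weight v" "in_Hv v f"
  shows "0 \<le> Hv_norm v f"
proof -
  have "0 \<le> v 0 * norm (f 0)" using weight_pos[OF assms(1), of 0] by simp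
  also have "\<dots> \<le> Hv_norm v f" by (rule in_Hv_bound[OF assms(2)]) simp
  finally show ?thesis .
qed

lemma in_HvI:
  assumes "f holomorphic_on unit_disc" "\<And>z. norm z < 1 \<Longrightarrow> v z * norm (f z) \<le> B"
  shows "in_Hv v f" "Hv_norm v f \<le> B"
proof -
  have b: "v z * norm (f z) \<le> B" if "z \<in> unit_disc" for z using assms(2) that by simp
  then have "bdd_above ((\<lambda>z. v z * norm (f z)) ` unit_disc)" by (rule bdd_aboveI2)
  then show "in_Hv v f" using assms(1) by (simp add: in_Hv_def)
  show "Hv_norm v f \<le> B" unfolding Hv_norm_def by (rule cSUP_least) (simp, rule b)
qed

text \<open>Every \<open>f\<close> in the unit ball is at most \<open>1 / v\<close> on both circles,
  so the annulus estimate passes to the supremum at \<open>r\<close>, which dominates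
  \<open>c / v\<close>.\<close>

lemma essential_annulus:
  assumes v: "is_weight v"
    and c: "c / v (complex_of_real r) \<le> Sup {norm (f (complex_of_real r)) | f. in_Hv v f \<and> Hv_norm v f \<le> 1}"
    and r: "0 < r1" "r1 < r" "r < r2" "r2 < 1"
  shows "c / v (complex_of_real r) / r ^ n
     \<le> max (1 / v (complex_of_real r1) / r1 ^ n) (1 / v (complex_of_real r2) / r2 ^ n)" (is "_ \<le> ?m")
proof -
  have "Sup {norm (f (complex_of_real r)) | f. in_Hv v f \<and> Hv_norm v f \<le> 1} \<le> ?m * r ^ n"
  proof (rule cSup_least)
    have "in_Hv v (\<lambda>_. 0)" "Hv_norm v (\<lambda>_. 0) \<le> 1"
      using in_HvI[of "\<lambda>_. 0" v 1] by simp_all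
    then show "{norm (f (complex_of_real r)) | f. in_Hv v f \<and> Hv_norm v f \<le> 1} \<noteq> {}" by blast
    fix y assume "y \<in> {norm (f (complex_of_real r)) | f. in_Hv v f \<and> Hv_norm v f \<le> 1}"
    then obtain f where f: "y = norm (f (complex_of_real r))" "in_Hv v f" "Hv_norm v f \<le> 1" by blast
    have bd: "norm (f z) \<le> 1 / v (complex_of_real (norm z))" if "norm z < 1" for z
    proof -
      have "norm (f z) \<le> Hv_norm v f / v z" by (rule in_Hv_norm_le[OF v f(2) that])
      also have "\<dots> \<le> 1 / v z" using f(3) weight_pos[OF v that] by (intro divide_right_mono) auto
      finally show ?thesis using weight_radial[OF v that] by simp
    qed
    have "norm (f (complex_of_real r)) / r ^ n \<le> ?m"
    proof (rule annulus_maximum_modulus[OF _ r])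
      show "f holomorphic_on unit_disc" using f by (simp add: in_Hv_def)
      show "norm (f z) \<le> 1 / v (complex_of_real r1)" if "norm z = r1" for z
        using bd[of z] that r by simp
      show "norm (f z) \<le> 1 / v (complex_of_real r2)" if "norm z = r2" for z
        using bd[of z] that r by simp
    qed
    then show "y \<le> ?m * r ^ n" using r f by (simp add: pos_divide_le_eq)
  qed
  with c have "c / v (complex_of_real r) \<le> ?m * r ^ n" by linarith
  then show ?thesis by (subst pos_divide_le_eq) (use r in auto)
qed

text \<open>For each exponent the monomial through the graph at \<open>r\<close>, scaled by
  \<open>c\<close>, lies below \<open>\<phi>\<close> on at least one side of \<open>r\<close>. The
  right side works for exponent 0 and fails eventually, so there is a last exponent for which it
  works before a failure.\<close>

lemma essential_tangent:
  assumes v: "is_weight v" and c: "0 < c"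
    and ess: "\<And>z. norm z < 1 \<Longrightarrow> c / v z \<le> Sup {norm (f z) | f. in_Hv v f \<and> Hv_norm v f \<le> 1}"
    and c1: "c \<le> 1" and r: "1/2 \<le> r" "r < 1"
  defines "\<phi> \<equiv> \<lambda>x. 1 / v (complex_of_real x)"
  shows "\<exists>m. \<forall>x\<in>{1/2..<1}. \<phi> r * (x / r) ^ m \<le> 2 / c * \<phi> x"
proof -
  have pos: "\<phi> x > 0" if "0 \<le> x" "x < 1" for x
    using weight_pos[OF v, of "complex_of_real x"] that by (simp add: \<phi>_def)
  define U where "U n \<longleftrightarrow> (\<forall>x. r < x \<longrightarrow> x < 1 \<longrightarrow> c * \<phi> r / r ^ n \<le> \<phi> x / x ^ n)" for n
  define L where "L n \<longleftrightarrow> (\<forall>x. 0 < x \<longrightarrow> x < r \<longrightarrow> c * \<phi> r / r ^ n \<le> \<phi> x / x ^ n)" for n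
  \<comment> \<open>A failure at \<open>x\<close> to the right and one at \<open>y\<close> to the
    left would contradict the estimate on the annulus between \<open>y\<close> and
    \<open>x\<close>.\<close>
  have dich: "U n \<or> L n" for n
  proof (rule ccontr)
    assume "\<not> (U n \<or> L n)"
    then obtain x y where xy: "r < x" "x < 1" "\<phi> x / x ^ n < c * \<phi> r / r ^ n"
      "0 < y" "y < r" "\<phi> y / y ^ n < c * \<phi> r / r ^ n"
      unfolding U_def L_def by (meson not_le)
    moreover have "c * \<phi> r / r ^ n \<le> max (\<phi> y / y ^ n) (\<phi> x / x ^ n)"
      using essential_annulus[OF v ess, of r y x n] xy r by (simp add: \<phi>_def)
    ultimately show False by linarith
  qed
  have U0: "U 0" unfolding U_def
  proof (intro allI impI)
    fix x assume x: "r < x" "x < 1"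
    then have "v (complex_of_real x) \<le> v (complex_of_real r)"
      using r by (intro weight_antimono[OF v]) auto
    then have "\<phi> r \<le> \<phi> x"
      using weight_pos[OF v, of "complex_of_real x"] x r by (simp add: \<phi>_def frac_le)
    moreover have "c * \<phi> r \<le> 1 * \<phi> r" using pos[of r] r c1 by (intro mult_right_mono) auto
    ultimately show "c * \<phi> r / r ^ 0 \<le> \<phi> x / x ^ 0" by simp
  qed
  \<comment> \<open>The last \<open>m\<close> with \<open>U m\<close> satisfies \<open>L (Suc m)\<close>; since \<open>x / r \<ge> 1/2\<close>, passing from \<open>Suc m\<close>
    to \<open>m\<close> costs only a factor 2.\<close>
  have "\<exists>n. \<not> U n"
  proof (rule ccontr)
    assume "\<not> ?thesis"
    then have U: "U n" for n by blast
    define y where "y = (r + 1) / 2"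
    have y: "r < y" "y < 1" using r by (auto simp: y_def)
    have cp: "c * \<phi> r > 0" using c pos[of r] r by simp
    have "1 < y / r" using y r by auto
    then obtain n where "\<phi> y / (c * \<phi> r) < (y / r) ^ n" using real_arch_pow by blast
    moreover have "c * \<phi> r / r ^ n \<le> \<phi> y / y ^ n" using U y unfolding U_def by blast
    then have "c * \<phi> r * (y / r) ^ n \<le> \<phi> y"
      using y r by (simp add: power_divide field_simps)
    ultimately show False using cp by (simp add: pos_divide_less_eq mult.commute)
  qed
  then obtain m where m: "U m" "\<not> U (Suc m)" using U0
    by (metis nat_induct)
  then have Lm: "L (Suc m)" using dich by blast
  have "\<phi> r * (x / r) ^ m \<le> 2 / c * \<phi> x" if x: "1/2 \<le> x" "x < 1" for x
  proof -
    have px: "\<phi> x > 0" "\<phi> r > 0" using pos x r by auto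
    consider "x = r" | "r < x" | "x < r" by linarith
    then have "c * (\<phi> r * (x / r) ^ m) \<le> 2 * \<phi> x"
    proof cases
      case 1
      have "c * \<phi> r \<le> 2 * \<phi> r" using px c1 by (intro mult_right_mono) auto
      then show ?thesis using 1 r by simp
    next
      case 2
      then have "c * \<phi> r / r ^ m \<le> \<phi> x / x ^ m" using m x unfolding U_def by blast
      then have "c * (\<phi> r * (x / r) ^ m) \<le> \<phi> x"
        using x r by (simp add: power_divide field_simps)
      then show ?thesis using px by simp
    next
      case 3
      then have "c * \<phi> r / r ^ Suc m \<le> \<phi> x / x ^ Suc m" using Lm x unfolding L_def by simp
      then have le: "c * (\<phi> r * (x / r) ^ Suc m) \<le> \<phi> x"
        using x r by (simp add: power_divide field_simps)
      have "c * (\<phi> r * (x / r) ^ m) * (1 / 2) \<le> c * (\<phi> r * (x / r) ^ m) * (x / r)"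
        using x r c px by (intro mult_left_mono) (auto simp: field_simps)
      moreover have "c * (\<phi> r * (x / r) ^ Suc m) = c * (\<phi> r * (x / r) ^ m) * (x / r)" by simp
      ultimately show ?thesis using le by linarith
    qed
    then show ?thesis using c by (simp add: field_simps)
  qed
  then show ?thesis by (intro exI[of _ m]) auto
qed

lemma essential_log_tangent:
  assumes v: "is_weight v" and "essential_weight v"
  obtains K where "log_tangent (\<lambda>x. 1 / v (complex_of_real x)) K"
proof -
  let ?\<phi> = "\<lambda>x. 1 / v (complex_of_real x)"
  obtain c where c: "0 < c"
    and ess: "\<And>z. norm z < 1 \<Longrightarrow> c / v z \<le> Sup {norm (f z) | f. in_Hv v f \<and> Hv_norm v f \<le> 1}"
    and ess2: "\<And>z. norm z < 1 \<Longrightarrow> Sup {norm (f z) | f. in_Hv v f \<and> Hv_norm v f \<le> 1} \<le> 1 / v z"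
    using assms(2) unfolding essential_weight_def by auto
  \<comment> \<open>Both halves of essentiality at 0 force \<open>c \<le> 1\<close>, which makes
    \<open>2 / c\<close> at least 1.\<close>
  have "c / v 0 \<le> 1 / v 0" using ess[of 0] ess2[of 0] by simp
  then have c1: "c \<le> 1" using weight_pos[OF v, of 0] by (simp add: divide_le_cancel)
  have vp: "v (complex_of_real x) > 0" if "0 \<le> x" "x < 1" for x
    using weight_pos[OF v] that by simp
  have "log_tangent ?\<phi> (2 / c)"
  proof
    show "continuous_on {0..<1} ?\<phi>"
    proof (intro continuous_intros)
      show "continuous_on {0..<1} (\<lambda>x. v (complex_of_real x))"
        by (rule weight_continuous_on_real[OF v])
      show "\<forall>x\<in>{0..<1}. v (complex_of_real x) \<noteq> 0" using vp by force
    qed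
    show "0 < ?\<phi> x" if "x \<in> {0..<1}" for x using vp that by simp
    show "?\<phi> x \<le> ?\<phi> y" if "0 \<le> x" "x \<le> y" "y < 1" for x y
    proof -
      have "v (complex_of_real y) \<le> v (complex_of_real x)"
        using that by (intro weight_antimono[OF v]) auto
      then show ?thesis using vp[of y] that by (simp add: frac_le)
    qed
    have "((\<lambda>x. v (complex_of_real x)) \<longlongrightarrow> 0) (at_left 1)"
      by (rule weight_tendsto[OF v])
    moreover have "\<forall>\<^sub>F x in at_left 1. 0 < v (complex_of_real x)"
      unfolding eventually_at_left_field using vp by (intro exI[of _ 0]) auto
    ultimately have "filterlim (\<lambda>x. v (complex_of_real x)) (at_right 0) (at_left 1)"
      by (auto simp: filterlim_at elim: eventually_mono)
    then show "filterlim ?\<phi> at_top (at_left 1)"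
      using filterlim_compose[OF filterlim_inverse_at_top_right] by (simp add: inverse_eq_divide)
    show "1 \<le> 2 / c" using c c1 by simp
    show "\<exists>m. \<forall>x\<in>{1/2..<1}. ?\<phi> r * (x / r) ^ m \<le> 2 / c * ?\<phi> x" if "r \<in> {1/2..<1}" for r
      using essential_tangent[OF v c ess c1, of r] that by simp
  qed
  then show ?thesis by (rule that)
qed

section \<open>The integral operator\<close>

context
  fixes M :: "real measure" and v w :: "complex \<Rightarrow> real"
  assumes M: "sets M = sets (restrict_space borel {0..<1::real})"
    and v: "is_weight v" and w: "is_weight w"
begin

lemma space_M: "space M = {0..<1}"
  using sets_eq_imp_space_eq[OF M] by (simp add: space_restrict_space)

lemma continuous_measurable_M:
  fixes f :: "real \<Rightarrow> 'a::topological_space"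
  assumes "continuous_on {0..<1} f"
  shows "f \<in> borel_measurable M"
  using borel_measurable_continuous_on_restrict[OF assms] measurable_cong_sets[OF M refl] by auto

lemma denom_nz: "0 \<le> t \<Longrightarrow> t < 1 \<Longrightarrow> norm z < 1 \<Longrightarrow> 1 - complex_of_real t * z \<noteq> 0"
proof
  assume "0 \<le> t" "t < 1" "norm z < 1" "1 - complex_of_real t * z = 0"
  then have "norm (complex_of_real t * z) = 1" by (metis eq_iff_diff_eq_0 norm_one)
  moreover have "norm (complex_of_real t * z) \<le> 1 * norm z"
    unfolding norm_mult using \<open>0 \<le> t\<close> \<open>t < 1\<close> by (intro mult_right_mono) auto
  ultimately show False using \<open>norm z < 1\<close> by simp
qed

lemma kernel_measurable:
  assumes "f holomorphic_on unit_disc" "norm z < 1"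
  shows "(\<lambda>t. f (complex_of_real t) / (1 - complex_of_real t * z)) \<in> borel_measurable M"
proof (intro continuous_measurable_M continuous_intros)
  show "continuous_on {0..<1} (\<lambda>t. f (complex_of_real t))"
    by (rule continuous_on_compose2[OF holomorphic_on_imp_continuous_on[OF assms(1)]])
      (auto intro!: continuous_intros)
qed (use denom_nz assms in auto)

section \<open>Sufficiency: absolute convergence, the norm bound and holomorphy\<close>

lemma weight_kernel_finite:
  assumes C: "C_vw M v w < \<infinity>" and r: "0 \<le> r" "r < 1"
  shows "w (complex_of_real r) * enn2real (\<integral>\<^sup>+ t. ennreal (1 / (v (complex_of_real t) * (1 - t * r))) \<partial>M)
      \<le> enn2real (C_vw M v w)" (is "?w * enn2real ?I \<le> _")
    and "(\<integral>\<^sup>+ t. ennreal (1 / (v (complex_of_real t) * (1 - t * r))) \<partial>M) < \<infinity>"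
proof -
  have wp: "?w > 0" using weight_pos[OF w] r by simp
  have le: "ennreal ?w * ?I \<le> C_vw M v w"
    unfolding C_vw_def using r by (intro SUP_upper2[of r]) auto
  then have "ennreal ?w * ?I < \<infinity>" using C by (rule le_less_trans)
  \<comment> \<open>Finiteness is recorded separately, since \<open>enn2real\<close> sends infinity
    to 0 and the first claim alone would not exclude it.\<close>
  then show "?I < \<infinity>" using wp by (auto simp: ennreal_mult_less_top)
  have "enn2real (ennreal ?w * ?I) \<le> enn2real (C_vw M v w)"
    using le C by (intro enn2real_mono) auto
  then show "?w * enn2real ?I \<le> enn2real (C_vw M v w)" using wp by (simp add: enn2real_mult)
qed

text \<open>The denominator satisfies \<open>norm (1 - t * z) \<ge> 1 - t * norm z\<close>, which
  reduces every \<open>z\<close> to the radius \<open>norm z\<close> occurring in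
  \<open>C_vw\<close>.\<close>

lemma norm_kernel_le:
  assumes f: "in_Hv v f" and z: "norm z < 1" and t: "t \<in> space M"
  shows "norm (f (complex_of_real t) / (1 - complex_of_real t * z))
     \<le> Hv_norm v f * (1 / (v (complex_of_real t) * (1 - t * norm z)))"
proof -
  have t: "0 \<le> t" "t < 1" using t by (auto simp: space_M)
  have "t * norm z \<le> 1 * norm z" using t by (intro mult_right_mono) auto
  then have tz: "0 < 1 - t * norm z" using z by simp
  have "norm (f (complex_of_real t)) \<le> Hv_norm v f / v (complex_of_real t)"
    using t by (intro in_Hv_norm_le v f) auto
  moreover have "1 - t * norm z \<le> norm (1 - complex_of_real t * z)"
    using norm_triangle_ineq2[of 1 "complex_of_real t * z"] t by (simp add: norm_mult)
  ultimately have "norm (f (complex_of_real t)) / norm (1 - complex_of_real t * z)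
      \<le> Hv_norm v f / v (complex_of_real t) / (1 - t * norm z)"
    using tz Hv_norm_nonneg[OF v f] weight_pos[OF v, of "complex_of_real t"] t by (intro frac_le) auto
  then show ?thesis by (simp add: norm_divide)
qed

lemma kernel_integrable:
  assumes C: "C_vw M v w < \<infinity>" and f: "in_Hv v f" and z: "norm z < 1"
  shows "integrable M (\<lambda>t. f (complex_of_real t) / (1 - complex_of_real t * z))"
    and "w z * norm (I_mu M f z) \<le> enn2real (C_vw M v w) * Hv_norm v f"
proof -
  let ?k = "\<lambda>t. f (complex_of_real t) / (1 - complex_of_real t * z)"
  let ?I = "\<integral>\<^sup>+ t. ennreal (1 / (v (complex_of_real t) * (1 - t * norm z))) \<partial>M"
  have H: "0 \<le> Hv_norm v f" by (rule Hv_norm_nonneg[OF v f])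
  have meas: "?k \<in> borel_measurable M" using f z by (intro kernel_measurable) (auto simp: in_Hv_def)
  have vm: "(\<lambda>t. ennreal (1 / (v (complex_of_real t) * (1 - t * norm z)))) \<in> borel_measurable M"
  proof -
    have [measurable]: "(\<lambda>t. v (complex_of_real t)) \<in> borel_measurable M"
      by (intro continuous_measurable_M weight_continuous_on_real[OF v])
    have [measurable]: "(\<lambda>t. t) \<in> borel_measurable M"
      by (intro continuous_measurable_M continuous_intros)
    show ?thesis by measurable
  qed
  have "(\<integral>\<^sup>+ t. ennreal (norm (?k t)) \<partial>M)
     \<le> (\<integral>\<^sup>+ t. ennreal (Hv_norm v f) * ennreal (1 / (v (complex_of_real t) * (1 - t * norm z))) \<partial>M)"
    using norm_kernel_le[OF f z] H
    by (intro nn_integral_mono) (simp add: ennreal_mult'[symmetric] ennreal_leI)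
  also have "\<dots> = ennreal (Hv_norm v f) * ?I" by (rule nn_integral_cmult[OF vm])
  finally have le: "(\<integral>\<^sup>+ t. ennreal (norm (?k t)) \<partial>M) \<le> ennreal (Hv_norm v f) * ?I" .
  have I: "?I < \<infinity>" using weight_kernel_finite(2)[OF C, of "norm z"] z by simp
  then have lt: "ennreal (Hv_norm v f) * ?I < \<infinity>" by (simp add: ennreal_mult_less_top)
  show int: "integrable M ?k"
    by (rule integrableI_bounded[OF meas]) (use le lt in \<open>rule le_less_trans\<close>)
  have wz: "w (complex_of_real (norm z)) = w z" "0 < w z"
    using weight_radial[OF w z] weight_pos[OF w z] by auto
  have "norm (I_mu M f z) \<le> (\<integral>t. norm (?k t) \<partial>M)"
    unfolding I_mu_def by (rule integral_norm_bound)
  also have "\<dots> = enn2real (\<integral>\<^sup>+ t. ennreal (norm (?k t)) \<partial>M)"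
    using meas by (intro integral_eq_nn_integral) auto
  also have "\<dots> \<le> enn2real (ennreal (Hv_norm v f) * ?I)" using le lt by (intro enn2real_mono) auto
  also have "\<dots> = Hv_norm v f * enn2real ?I" using H by (simp add: enn2real_mult)
  finally have "w z * norm (I_mu M f z) \<le> w z * (Hv_norm v f * enn2real ?I)"
    using wz by (intro mult_left_mono) auto
  also have "\<dots> = Hv_norm v f * (w z * enn2real ?I)" by simp
  also have "\<dots> \<le> Hv_norm v f * enn2real (C_vw M v w)"
    using weight_kernel_finite(1)[OF C, of "norm z"] z wz H by (intro mult_left_mono) auto
  finally show "w z * norm (I_mu M f z) \<le> enn2real (C_vw M v w) * Hv_norm v f"
    by (simp add: mult.commute)
qed

text \<open>The Taylor coefficients are the moments of \<open>f\<close> against \<open>M\<close>.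
  The terms are dominated by \<open>norm (f t) * norm z ^ n\<close>, so integrability of
  \<open>f\<close> alone justifies exchanging sum and integral.\<close>

lemma I_mu_holomorphic:
  assumes f: "f holomorphic_on unit_disc" and int: "integrable M (\<lambda>t. f (complex_of_real t))"
  shows "I_mu M f holomorphic_on unit_disc"
proof (rule power_series_holomorphic[where a = "\<lambda>n. \<integral>t. f (complex_of_real t) * complex_of_real t ^ n \<partial>M"])
  fix z :: complex assume "z \<in> unit_disc"
  then have z: "norm z < 1" by simp
  let ?f = "\<lambda>t. f (complex_of_real t)"
  let ?a = "\<lambda>n. \<integral>t. ?f t * complex_of_real t ^ n \<partial>M"
  let ?F = "\<lambda>n t. ?f t * complex_of_real t ^ n * z ^ n"
  have bd: "norm (?f t * complex_of_real t ^ n) \<le> norm (?f t)" if "t \<in> space M" for n t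
    using that by (auto simp: space_M norm_mult norm_power intro!: mult_left_le power_le_one)
  have m: "(\<lambda>t. ?f t * complex_of_real t ^ n) \<in> borel_measurable M" for n
    by (intro borel_measurable_times borel_measurable_integrable[OF int]
        continuous_measurable_M continuous_intros)
  have i: "integrable M (\<lambda>t. ?f t * complex_of_real t ^ n)" for n
    by (rule Bochner_Integration.integrable_bound[OF int m]) (use bd in auto)
  have nF: "norm (?F n t) \<le> norm (?f t) * norm z ^ n" if "t \<in> space M" for n t
    using mult_right_mono[OF bd[OF that, of n], of "norm z ^ n"] by (simp add: norm_mult norm_power)
  have geo: "summable (\<lambda>n. c * norm z ^ n)" for c :: real
    using z by (intro summable_mult summable_geometric) simp
  have "(\<lambda>n. integral\<^sup>L M (?F n)) sums (\<integral>t. (\<Sum>n. ?F n t) \<partial>M)"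
  proof (rule sums_integral)
    show "integrable M (?F n)" for n by (intro integrable_mult_left i)
    show "AE t in M. summable (\<lambda>n. norm (?F n t))"
      by (intro AE_I2 summable_comparison_test'[OF geo]) (use nF in auto)
    show "summable (\<lambda>n. \<integral>t. norm (?F n t) \<partial>M)"
    proof (rule summable_comparison_test'[OF geo])
      fix n
      have "(\<integral>t. norm (?F n t) \<partial>M) \<le> (\<integral>t. norm (?f t) * norm z ^ n \<partial>M)"
        using i int nF by (intro integral_mono integrable_norm integrable_mult_left) auto
      then show "norm (\<integral>t. norm (?F n t) \<partial>M) \<le> (\<integral>t. norm (?f t) \<partial>M) * norm z ^ n" by simp
    qed
  qed
  moreover have "(\<integral>t. (\<Sum>n. ?F n t) \<partial>M) = I_mu M f z"
    unfolding I_mu_def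
  proof (rule Bochner_Integration.integral_cong)
    fix t assume "t \<in> space M"
    then have t: "0 \<le> t" "t < 1" by (auto simp: space_M)
    have "t * norm z \<le> 1 * norm z" using t by (intro mult_right_mono) auto
    then have "norm (complex_of_real t * z) < 1" using t z by (simp add: norm_mult)
    then have "(\<lambda>n. ?f t * (complex_of_real t * z) ^ n) sums (?f t * (1 / (1 - complex_of_real t * z)))"
      by (intro sums_mult geometric_sums)
    then show "(\<Sum>n. ?F n t) = ?f t / (1 - complex_of_real t * z)"
      by (simp add: sums_iff power_mult_distrib mult.assoc)
  qed simp
  ultimately show "(\<lambda>n. ?a n * (z - 0) ^ n) sums I_mu M f z"
    using i by simp
qed

lemma C_vw_imp_bounded:
  assumes C: "C_vw M v w < \<infinity>"
  shows "I_mu_bounded M v w"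
proof -
  have "in_Hv w (I_mu M f) \<and> Hv_norm w (I_mu M f) \<le> enn2real (C_vw M v w) * Hv_norm v f"
    if f: "in_Hv v f" for f
  proof -
    \<comment> \<open>At \<open>z = 0\<close> the kernel is 1.\<close>
    have "integrable M (\<lambda>t. f (complex_of_real t))"
      using kernel_integrable(1)[OF C f, of 0] by simp
    then have "I_mu M f holomorphic_on unit_disc"
      using f by (intro I_mu_holomorphic) (auto simp: in_Hv_def)
    then show ?thesis
      using in_HvI[of "I_mu M f" w, OF _ kernel_integrable(2)[OF C f]] by blast
  qed
  then show ?thesis unfolding I_mu_bounded_def using kernel_integrable(1)[OF C] by auto
qed

section \<open>Necessity: the operator applied to the test polynomials\<close>

lemma bounded_imp_C_vw:
  assumes ess: "essential_weight v" and bdd: "I_mu_bounded M v w"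
  shows "C_vw M v w < \<infinity>"
proof -
  let ?\<phi> = "\<lambda>x. 1 / v (complex_of_real x)"
  obtain K where "log_tangent ?\<phi> K" using essential_log_tangent[OF v ess] .
  then interpret log_tangent ?\<phi> K .
  have Q0: "0 \<le> test_real n x" if "0 \<le> x" for n x
    using order_trans[OF norm_ge_zero norm_test_poly_le[of n "complex_of_real x"]] that by simp
  have PH: "in_Hv v (test_poly n)" "Hv_norm v (test_poly n) \<le> test_bound" for n
  proof -
    have hol: "test_poly n holomorphic_on unit_disc" by (rule test_poly_holomorphic)
    have b: "v z * norm (test_poly n z) \<le> test_bound" if "norm z < 1" for z
    proof -
      have "norm (test_poly n z) \<le> test_bound * ?\<phi> (norm z)" using norm_test_poly_le[of n z] test_real_le[of "norm z" n] that by simp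
      then show ?thesis
        using weight_pos[OF v that] weight_radial[OF v that] by (simp add: field_simps)
    qed
    show "in_Hv v (test_poly n)" "Hv_norm v (test_poly n) \<le> test_bound" using in_HvI[OF hol b] by auto
  qed
  have wd: "integrable M (\<lambda>t. f (complex_of_real t) / (1 - complex_of_real t * z))"
    if "in_Hv v f" "norm z < 1" for f z
  proof -
    have "z \<in> unit_disc" using that by simp
    then show ?thesis using bdd that(1) unfolding I_mu_bounded_def by blast
  qed
  have Hw: "in_Hv w (I_mu M f)" if "in_Hv v f" for f
    using bdd that unfolding I_mu_bounded_def by blast
  obtain E where E: "in_Hv v f \<Longrightarrow> Hv_norm w (I_mu M f) \<le> E * Hv_norm v f" for f
    using bdd unfolding I_mu_bounded_def by blast
  \<comment> \<open>The constant in \<open>I_mu_bounded\<close> carries no sign, hence the absolute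
    value.\<close>
  define B where "B = \<bar>E\<bar> * test_bound"
  have "ennreal (w (complex_of_real r)) *
      (\<integral>\<^sup>+ t. ennreal (1 / (v (complex_of_real t) * (1 - t * r))) \<partial>M) \<le> ennreal (K * B)"
    if r: "0 \<le> r" "r < 1" for r
  proof -
    let ?w = "w (complex_of_real r)"
    let ?q = "\<lambda>n t. test_real n t / (1 - t * r)"
    have wp: "?w > 0" using weight_pos[OF w] r by simp
    have tr: "0 < 1 - t * r" if "t \<in> space M" for t
      using mult_right_mono[of t 1 r] that r by (auto simp: space_M)
    have q0: "0 \<le> ?q n t" if "t \<in> space M" for n t
      using Q0[of t n] tr[OF that] that by (auto simp: space_M)
    have kq: "test_poly n (complex_of_real t) / (1 - complex_of_real t * complex_of_real r)
        = complex_of_real (?q n t)" for n t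
      by (simp add: test_poly_of_real)
    \<comment> \<open>Well-definedness of the operator supplies the integrability by which the
      Bochner integral may later be replaced by the nonnegative one.\<close>
    have ic: "integrable M (\<lambda>t. complex_of_real (?q n t))" for n
      using wd[OF PH(1)[of n], of "complex_of_real r"] r by (simp only: kq) simp
    then have iq: "integrable M (?q n)" for n
      using integrable_Re[OF ic] by simp
    have Iq: "?w * (\<integral>t. ?q n t \<partial>M) \<le> B" for n
    proof -
      have "I_mu M (test_poly n) (complex_of_real r) = complex_of_real (\<integral>t. ?q n t \<partial>M)"
        unfolding I_mu_def kq by (rule integral_complex_of_real)
      moreover have "0 \<le> (\<integral>t. ?q n t \<partial>M)" using q0 by (intro integral_nonneg_AE AE_I2) auto
      ultimately have "?w * (\<integral>t. ?q n t \<partial>M) = ?w * norm (I_mu M (test_poly n) (complex_of_real r))" by simp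
      also have "\<dots> \<le> Hv_norm w (I_mu M (test_poly n))"
        using r by (intro in_Hv_bound Hw PH) simp
      also have "\<dots> \<le> E * Hv_norm v (test_poly n)" by (rule E[OF PH(1)])
      also have "\<dots> \<le> \<bar>E\<bar> * test_bound"
        using PH(2)[of n] Hv_norm_nonneg[OF v PH(1)[of n]] by (intro mult_mono) auto
      finally show ?thesis by (simp add: B_def)
    qed
    have nq: "(\<integral>\<^sup>+ t. ennreal (?q n t) \<partial>M) = ennreal (\<integral>t. ?q n t \<partial>M)" for n
      using q0 by (intro nn_integral_eq_integral iq AE_I2)
    \<comment> \<open>The index \<open>n\<close> from \<open>le_test_real\<close> varies with
      \<open>t\<close>; the supremum inside the integral absorbs this, and monotone convergence then
      moves it outside.\<close>
    have "(\<integral>\<^sup>+ t. ennreal (1 / (v (complex_of_real t) * (1 - t * r))) \<partial>M)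
        \<le> (\<integral>\<^sup>+ t. ennreal K * (SUP n. ennreal (?q n t)) \<partial>M)"
    proof (rule nn_integral_mono)
      fix t assume t: "t \<in> space M"
      then obtain n where n: "?\<phi> t \<le> K * test_real n t" using le_test_real[of t] by (auto simp: space_M)
      have "1 / (v (complex_of_real t) * (1 - t * r)) = ?\<phi> t / (1 - t * r)" by simp
      also have "\<dots> \<le> K * ?q n t" using divide_right_mono[OF n, of "1 - t * r"] tr[OF t] by simp
      finally have "ennreal (1 / (v (complex_of_real t) * (1 - t * r))) \<le> ennreal (K * ?q n t)"
        by (rule ennreal_leI)
      also have "\<dots> = ennreal K * ennreal (?q n t)"
        using K q0[OF t] by (intro ennreal_mult) auto
      also have "\<dots> \<le> ennreal K * (SUP n. ennreal (?q n t))"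
        by (intro mult_left_mono SUP_upper) auto
      finally show "ennreal (1 / (v (complex_of_real t) * (1 - t * r)))
         \<le> ennreal K * (SUP n. ennreal (?q n t))" .
    qed
    also have "\<dots> = ennreal K * (\<integral>\<^sup>+ t. (SUP n. ennreal (?q n t)) \<partial>M)"
      using iq by (intro nn_integral_cmult borel_measurable_SUP) auto
    also have "(\<integral>\<^sup>+ t. (SUP n. ennreal (?q n t)) \<partial>M) = (SUP n. \<integral>\<^sup>+ t. ennreal (?q n t) \<partial>M)"
    proof (rule nn_integral_monotone_convergence_SUP_AE)
      show "AE t in M. ennreal (?q n t) \<le> ennreal (?q (Suc n) t)" for n
        using test_real_mono[of _ n "Suc n"] tr
        by (intro AE_I2 ennreal_leI divide_right_mono) (auto simp: space_M less_imp_le)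
    qed (use iq in auto)
    also have "\<dots> \<le> ennreal (B / ?w)"
      using Iq wp by (intro SUP_least) (simp add: nq ennreal_leI field_simps)
    finally have "(\<integral>\<^sup>+ t. ennreal (1 / (v (complex_of_real t) * (1 - t * r))) \<partial>M)
      \<le> ennreal K * ennreal (B / ?w)" by (simp add: mult_left_mono)
    then have "ennreal ?w * (\<integral>\<^sup>+ t. ennreal (1 / (v (complex_of_real t) * (1 - t * r))) \<partial>M)
      \<le> ennreal ?w * (ennreal K * ennreal (B / ?w))"
      by (rule mult_left_mono) simp
    also have "\<dots> = ennreal (K * B)"
      using wp K by (simp add: ennreal_mult'[symmetric] mult_ac)
    finally show ?thesis .
  qed
  then have "C_vw M v w \<le> ennreal (K * B)" unfolding C_vw_def by (intro SUP_least) auto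
  then show ?thesis by (rule le_less_trans) simp
qed

end

theorem theorem8:
  fixes M :: "real measure" and v w :: "complex \<Rightarrow> real"
  assumes "sets M = sets (restrict_space borel {0..<1::real})"
    and "finite_measure M"
    and "is_weight v" and "is_weight w"
  shows "(C_vw M v w < \<infinity> \<longrightarrow> I_mu_bounded M v w) \<and>
         (essential_weight v \<longrightarrow> (C_vw M v w < \<infinity> \<longleftrightarrow> I_mu_bounded M v w))"
  using C_vw_imp_bounded[OF assms(1,3,4)] bounded_imp_C_vw[OF assms(1,3,4)] by blast

end
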